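(* Let $0\leq\beta<1$, $\lambda\geq 1$ and $\mu\geq 0$ be real numbers, and let $f(z)=z+\sum_{n=2}^{\infty}a_n z^n$ be a function in the class $\mathcal{N}_{\Sigma}^{\mu}(\beta,\lambda)$. Then $$|a_2|\leq \min\left\{\sqrt{\frac{4(1-\beta)}{(\mu+1)(2\lambda+\mu)}},\ \frac{2(1-\beta)}{\lambda+\mu}\right\}$$ and $$|a_3|\leq \begin{cases}\min\left\{\dfrac{4(1-\beta)}{(\mu+1)(2\lambda+\mu)},\ \dfrac{4(1-\beta)^2}{(\lambda+\mu)^2}+\dfrac{2(1-\beta)}{2\lambda+\mu}\right\}, & 0\leq\mu<1,\\[2ex] \dfrac{2(1-\beta)}{2\lambda+\mu}, & \mu\geq 1.\end{cases}$$
   Context: Let $\mathcal{U}=\{z\in\mathbb{C}:|z|<1\}$ and let $\mathcal{A}$ be the family of functions $f$ analytic in $\mathcal{U}$ of the form $f(z)=z+\sum_{n=2}^{\infty}a_nz^n$. A function $f\in\mathcal{A}$ is bi-univalent in $\mathcal{U}$ if $f$ is univalent (injective) in $\mathcal{U}$ and its inverse $f^{-1}$, which is defined near $0$, extends to a univalent analytic function $g$ on $\mathcal{U}$; thus $g(w)=w-a_2w^2+(2a_2^2-a_3)w^3-(5a_2^3-5a_2a_3+a_4)w^4+\cdots$. $\Sigma$ denotes the class of bi-univalent functions. For $0\le\beta<1$, $\mu\ge 0$ and $\lambda\ge 1$, a function $f\in\mathcal{A}$ belongs to $\mathcal{N}_{\Sigma}^{\mu}(\beta,\lambda)$ if $f\in\Sigma$,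 $$\Re\left((1-\lambda)\left(\frac{f(z)}{z}\right)^{\mu}+\lambda f'(z)\left(\frac{f(z)}{z}\right)^{\mu-1}\right)>\beta\quad (z\in\mathcal{U})$$ and, with $g$ the extension of $f^{-1}$ to $\mathcal{U}$, $$\Re\left((1-\lambda)\left(\frac{g(w)}{w}\right)^{\mu}+\lambda g'(w)\left(\frac{g(w)}{w}\right)^{\mu-1}\right)>\beta\quad (w\in\mathcal{U}).$$ Here $f(z)/z$ and $g(w)/w$ are understood as the analytic non-vanishing functions on $\mathcal{U}$ equal to $1$ at the origin, and the powers are the analytic branches equal to $1$ at the origin. *)

theory Defs
  imports "HOL-Complex_Analysis.Complex_Analysis"
begin

abbreviation unit_disc :: "complex set" where
  "unit_disc \<equiv> ball 0 1"

text \<open>The entries \<open>a 0\<close> and \<open>a 1\<close> are irrelevant.\<close>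

definition normalized_expansion :: "(complex \<Rightarrow> complex) \<Rightarrow> (nat \<Rightarrow> complex) \<Rightarrow> bool" where
  "normalized_expansion f a \<longleftrightarrow>
     (\<forall>z\<in>unit_disc. (\<lambda>n. a (n + 2) * z ^ (n + 2)) sums (f z - z))"

definition class_A :: "(complex \<Rightarrow> complex) set" where
  "class_A = {f. f analytic_on unit_disc \<and> (\<exists>a. normalized_expansion f a)}"

definition univalent :: "(complex \<Rightarrow> complex) \<Rightarrow> bool" where
  "univalent f \<longleftrightarrow> f analytic_on unit_disc \<and> inj_on f unit_disc"

text \<open>For univalent \<open>f\<close> the inverse is a function on \<open>f ` unit_disc\<close>; the function \<open>g\<close> has to agree
  with it on some disc around 0.  By the identity theorem the values of \<open>g\<close> on the unit disc are
  then determined by \<open>f\<close>.\<close>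

definition univalent_inverse_extension ::
    "(complex \<Rightarrow> complex) \<Rightarrow> (complex \<Rightarrow> complex) \<Rightarrow> bool" where
  "univalent_inverse_extension f g \<longleftrightarrow> univalent g \<and>
     (\<exists>r>0. ball 0 r \<subseteq> f ` unit_disc \<and> (\<forall>w\<in>ball 0 r. g w = the_inv_into unit_disc f w))"

definition bi_univalent_class :: "(complex \<Rightarrow> complex) set" where
  "bi_univalent_class =
     {f \<in> class_A. univalent f \<and> (\<exists>g. univalent_inverse_extension f g)}"

definition quotient_by_id :: "(complex \<Rightarrow> complex) \<Rightarrow> complex \<Rightarrow> complex" where
  "quotient_by_id f z = (if z = 0 then 1 else f z / z)"

definition is_log_branch :: "(complex \<Rightarrow> complex) \<Rightarrow> (complex \<Rightarrow> complex) \<Rightarrow> bool" where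
  "is_log_branch h L \<longleftrightarrow>
     L analytic_on unit_disc \<and> L 0 = 0 \<and> (\<forall>z\<in>unit_disc. exp (L z) = h z)"

text \<open>The branch on the unit disc, equal to 1 at the origin, of the real power \<open>s\<close> of an analytic
  non-vanishing function \<open>h\<close> with \<open>h 0 = 1\<close>.  The principal branch \<open>powr\<close> would be wrong here, since
  \<open>h\<close> may take values on the negative real axis.  The choice of the logarithm is immaterial on the
  unit disc, see the lemmas below.\<close>

definition branch_power :: "(complex \<Rightarrow> complex) \<Rightarrow> real \<Rightarrow> complex \<Rightarrow> complex" where
  "branch_power h s z = exp (of_real s * (SOME L. is_log_branch h L) z)"

lemma is_log_branch_exists:
  assumes "h analytic_on unit_disc" "\<And>z. z \<in> unit_disc \<Longrightarrow> h z \<noteq> 0" "h 0 = 1"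
  shows "\<exists>L. is_log_branch h L"
proof -
  have "h holomorphic_on unit_disc"
    using assms(1) analytic_imp_holomorphic by blast
  then obtain L where L: "L holomorphic_on unit_disc" "\<And>z. z \<in> unit_disc \<Longrightarrow> h z = exp (L z)"
    using contractible_imp_holomorphic_log[of h unit_disc] assms(2)
    by (auto intro: convex_imp_contractible)
  have "exp (L 0) = 1"
    using L(2)[of 0] assms(3) by simp
  then have "is_log_branch h (\<lambda>z. L z - L 0)"
    using L by (auto simp: is_log_branch_def analytic_on_open exp_diff intro!: holomorphic_intros)
  then show ?thesis by blast
qed

lemma is_log_branch_unique:
  assumes "is_log_branch h L" "is_log_branch h M" "z \<in> unit_disc"
  shows "L z = M z"
proof -
  let ?D = "\<lambda>z. L z - M z"
  have hol: "L holomorphic_on unit_disc" "M holomorphic_on unit_disc"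
    using assms unfolding is_log_branch_def by (auto intro: analytic_imp_holomorphic)
  have e: "exp (?D z) = 1" if "z \<in> unit_disc" for z
  proof -
    have "exp (L z) = exp (M z)"
      using assms(1,2) that by (simp add: is_log_branch_def)
    then show ?thesis
      by (simp add: exp_diff)
  qed
  have "(?D has_field_derivative 0) (at w within unit_disc)" if "w \<in> unit_disc" for w
  proof -
    have d: "(?D has_field_derivative deriv ?D w) (at w)"
      using hol that by (intro holomorphic_derivI[of _ unit_disc]) (auto intro!: holomorphic_intros)
    have "((\<lambda>z. exp (?D z)) has_field_derivative exp (?D w) * deriv ?D w) (at w)"
      by (rule DERIV_chain2[OF DERIV_exp d])
    moreover have "((\<lambda>z. exp (?D z)) has_field_derivative 0) (at w)"
      by (rule has_field_derivative_transform_within_open[where f = "\<lambda>_. 1" and S = unit_disc])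
        (use e that in auto)
    ultimately have "exp (?D w) * deriv ?D w = 0"
      using DERIV_unique by blast
    then show ?thesis
      using d by (auto intro: has_field_derivative_at_within)
  qed
  then obtain c where "\<And>w. w \<in> unit_disc \<Longrightarrow> ?D w = c"
    using has_field_derivative_zero_constant[of unit_disc ?D] by auto
  then have "?D z = ?D 0"
    using assms(3) by (metis centre_in_ball zero_less_one)
  then show ?thesis
    using assms(1,2) unfolding is_log_branch_def by simp
qed

lemma branch_power_eq:
  assumes "is_log_branch h L" "z \<in> unit_disc"
  shows "branch_power h s z = exp (of_real s * L z)"
  using is_log_branch_unique[OF someI[of "is_log_branch h", OF assms(1)] assms]
  by (simp add: branch_power_def)

definition half_plane_condition :: "real \<Rightarrow> real \<Rightarrow> real \<Rightarrow> (complex \<Rightarrow> complex) \<Rightarrow> bool" where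
  "half_plane_condition \<mu> \<beta> lam f \<longleftrightarrow>
     (\<forall>z\<in>unit_disc.
        Re ((1 - of_real lam) * branch_power (quotient_by_id f) \<mu> z
            + of_real lam * deriv f z * branch_power (quotient_by_id f) (\<mu> - 1) z) > \<beta>)"

definition class_N :: "real \<Rightarrow> real \<Rightarrow> real \<Rightarrow> (complex \<Rightarrow> complex) set" where
  "class_N \<mu> \<beta> lam =
     {f \<in> bi_univalent_class. half_plane_condition \<mu> \<beta> lam f \<and>
        (\<exists>g. univalent_inverse_extension f g \<and> half_plane_condition \<mu> \<beta> lam g)}"

end

theory Submission
  imports Defs
begin

text \<open>Write the two defining expressions of \<open>f\<close> and \<open>g\<close> as \<open>\<beta> + (1 - \<beta>) p\<close> and
  \<open>\<beta> + (1 - \<beta>) q\<close> with \<open>p\<close>, \<open>q\<close> of positive real part, so that all coefficients of \<open>p\<close> and \<open>q\<close>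
  of positive order are bounded by 2. The first coefficients give \<open>(lam + \<mu>) a\<^sub>2 = (1 - \<beta>) p\<^sub>1\<close>, the
  second ones express \<open>a\<^sub>3 + (\<mu> - 1) a\<^sub>2\<^sup>2 / 2\<close> and \<open>(\<mu> + 3) a\<^sub>2\<^sup>2 / 2 - a\<^sub>3\<close> through \<open>p\<^sub>2\<close> and \<open>q\<^sub>2\<close>.
  Their sum bounds \<open>a\<^sub>2\<^sup>2\<close>, their difference bounds \<open>a\<^sub>3 - a\<^sub>2\<^sup>2\<close>, and eliminating \<open>a\<^sub>2\<^sup>2\<close>
  yields \<open>2 (\<mu> + 1) (2 lam + \<mu>) a\<^sub>3 = (1 - \<beta>) ((\<mu> + 3) p\<^sub>2 + (1 - \<mu>) q\<^sub>2)\<close>; the change of sign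
  of \<open>1 - \<mu>\<close> explains the two cases.\<close>

section \<open>Coefficient bounds for functions of positive real part\<close>

lemma fps_nth_le_1_of_maps_into_unit_disc:
  assumes "f holomorphic_on unit_disc" "\<And>z. z \<in> unit_disc \<Longrightarrow> cmod (f z) \<le> 1"
    and "f has_fps_expansion F"
  shows "cmod (fps_nth F n) \<le> 1"
proof -
  \<comment> \<open>\<open>f\<close> need not extend to the unit circle, so Cauchy's inequality is
    used on circles of radius \<open>r < 1\<close>; the factor \<open>r ^ n\<close> disappears as
    \<open>r\<close> tends to 1.\<close>
  have bound: "cmod (fps_nth F n) * r ^ n \<le> 1" if r: "0 < r" "r < 1" for r
  proof -
    have sub: "cball 0 r \<subseteq> unit_disc"
      using r by auto
    have "norm ((deriv ^^ n) f 0) \<le> fact n * 1 / r ^ n"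
    proof (rule Cauchy_inequality)
      show "f holomorphic_on ball 0 r"
        using assms(1) sub ball_subset_cball by (metis holomorphic_on_subset)
      show "continuous_on (cball 0 r) f"
        using assms(1) sub by (meson holomorphic_on_imp_continuous_on holomorphic_on_subset)
    qed (use r assms(2) in auto)
    then show ?thesis
      using r by (simp add: fps_nth_fps_expansion[OF assms(3)] norm_divide field_simps)
  qed
  have "((\<lambda>r. cmod (fps_nth F n) * r ^ n) \<longlongrightarrow> cmod (fps_nth F n) * 1 ^ n) (at_left 1)"
    by (intro tendsto_intros)
  moreover have "eventually (\<lambda>r. cmod (fps_nth F n) * r ^ n \<le> 1) (at_left (1::real))"
    using eventually_at_left_real[of 0 1] by (rule eventually_mono) (auto intro: bound)
  ultimately have "cmod (fps_nth F n) * 1 ^ n \<le> 1"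
    by (rule tendsto_upperbound) auto
  then show ?thesis
    by simp
qed

text \<open>The squares of \<open>cmod (q + 1)\<close> and \<open>cmod (q - 1)\<close> differ by
  \<open>4 * Re q\<close>.\<close>

lemma norm_Cayley_less_1:
  assumes "Re q > 0"
  shows "cmod ((q - 1) / (q + 1)) < 1"
proof -
  have "cmod (q - 1) ^ 2 < cmod (q + 1) ^ 2"
    using assms unfolding cmod_power2 by (simp add: power2_eq_square algebra_simps)
  then have "cmod (q - 1) < cmod (q + 1)"
    by (rule power_less_imp_less_base) simp
  then show ?thesis
    by (simp add: norm_divide divide_less_eq)
qed

text \<open>Averaging \<open>p\<close> over the \<open>n\<close>-th roots of unity removes the coefficients of order \<open>1, \<dots>, n - 1\<close>
  and keeps the \<open>n\<close>-th one, which then is twice the \<open>n\<close>-th coefficient of the Cayley transform.\<close>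

lemma Caratheodory_coefficient_bound:
  assumes hol: "p holomorphic_on unit_disc" and pos: "\<And>z. z \<in> unit_disc \<Longrightarrow> Re (p z) > 0"
    and P: "p has_fps_expansion P" and P0: "fps_nth P 0 = 1" and n: "n > 0"
  shows "cmod (fps_nth P n) \<le> 2"
proof -
  define \<omega> where "\<omega> = exp (2 * of_real pi * \<i> * of_nat 1 / of_nat n)"
  have \<omega>_power: "\<omega> ^ m = exp (2 * of_real pi * \<i> * of_nat m / of_nat n)" for m
    unfolding \<omega>_def by (simp flip: exp_of_nat_mult add: mult_ac)
  have \<omega>_n: "\<omega> ^ n = 1"
    using n by (simp add: \<omega>_power)
  have norm_\<omega>: "cmod (\<omega> ^ k) = 1" for k
    unfolding \<omega>_power norm_exp_eq_Re by simp
  \<comment> \<open>Here \<open>\<omega> ^ m\<close> is an \<open>n\<close>-th root of unity other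
    than 1, so its geometric sum of length \<open>n\<close> vanishes.\<close>
  have \<omega>_sum: "(\<Sum>k<n. (\<omega> ^ k) ^ m) = 0" if "0 < m" "m < n" for m
  proof -
    have "\<omega> ^ m \<noteq> 1"
      unfolding \<omega>_power using complex_root_unity_eq_1[of n m] n that by (auto dest: dvd_imp_le)
    moreover have "(\<Sum>k<n. (\<omega> ^ k) ^ m) = (\<Sum>k<n. (\<omega> ^ m) ^ k)"
      by (simp flip: power_mult add: mult.commute)
    moreover have "(\<omega> ^ m) ^ n = 1"
      using \<omega>_n by (metis power_mult mult.commute power_one)
    ultimately show ?thesis
      by (simp add: geometric_sum)
  qed
  \<comment> \<open>The rotations map the disc to itself, so the average \<open>q\<close> again has
    positive real part.\<close>
  define q where "q z = (1 / of_nat n) * (\<Sum>k<n. (p \<circ> (\<lambda>z. \<omega> ^ k * z)) z)" for z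
  define Q where "Q = fps_const (1 / of_nat n) * (\<Sum>k<n. P oo (fps_const (\<omega> ^ k) * fps_X))"
  have Q: "q has_fps_expansion Q"
    unfolding q_def Q_def
    by (intro fps_expansion_intros P) simp_all
  have Q_nth: "fps_nth Q m = fps_nth P m * (\<Sum>k<n. (\<omega> ^ k) ^ m) / of_nat n" for m
    unfolding Q_def fps_mult_left_const_nth fps_sum_nth fps_nth_compose_linear
    by (simp flip: sum_distrib_right)
  have Q0: "fps_nth Q 0 = 1"
    using n P0 unfolding Q_nth by simp
  have Qm: "fps_nth Q m = 0" if "0 < m" "m < n" for m
    unfolding Q_nth \<omega>_sum[OF that] by simp
  have Qn: "fps_nth Q n = fps_nth P n"
  proof -
    have "(\<omega> ^ k) ^ n = 1" for k
      using \<omega>_n by (metis power_mult mult.commute power_one)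
    then show ?thesis
      using n unfolding Q_nth by simp
  qed
  have rot: "\<omega> ^ k * z \<in> unit_disc" if "z \<in> unit_disc" for k z
    using that norm_\<omega>[of k] by (simp add: norm_mult)
  have q_hol: "q holomorphic_on unit_disc"
    unfolding q_def using rot
    by (intro holomorphic_intros holomorphic_on_compose_gen[OF _ hol]) auto
  have q_pos: "Re (q z) > 0" if "z \<in> unit_disc" for z
  proof -
    have "Re (q z) = (\<Sum>k<n. Re (p (\<omega> ^ k * z))) / n"
      unfolding q_def by (simp flip: of_nat_Suc)
    moreover have "(\<Sum>k<n. Re (p (\<omega> ^ k * z))) > 0"
      using n pos[OF rot[OF that]] by (intro sum_pos) auto
    ultimately show ?thesis
      using n by simp
  qed
  have q_ne: "q z + 1 \<noteq> 0" if "z \<in> unit_disc" for z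
    using q_pos[OF that] by (auto simp: complex_eq_iff)
  define w where "w z = (q z - 1) / (q z + 1)" for z
  have w_hol: "w holomorphic_on unit_disc"
    unfolding w_def using q_ne by (intro holomorphic_intros q_hol) auto
  define W where "W = fps_expansion w 0"
  have W: "w has_fps_expansion W"
    unfolding W_def using w_hol by (intro has_fps_expansion_fps_expansion[of unit_disc]) auto
  have "(\<lambda>z. w z * (q z + 1)) has_fps_expansion W * (Q + 1)"
    by (intro fps_expansion_intros W Q)
  \<comment> \<open>Clearing the denominator of the Cayley transform near 0 turns its definition
    into an identity of formal power series.\<close>
  moreover have "(\<lambda>z. w z * (q z + 1)) has_fps_expansion Q - 1 \<longleftrightarrow>
      (\<lambda>z. q z - 1) has_fps_expansion Q - 1"
  proof (rule has_fps_expansion_cong[OF _ refl])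
    show "\<forall>\<^sub>F z in nhds 0. w z * (q z + 1) = q z - 1"
      using q_ne unfolding w_def
      by (intro eventually_mono[OF eventually_nhds_in_open[of unit_disc]]) auto
  qed
  moreover have "(\<lambda>z. q z - 1) has_fps_expansion Q - 1"
    by (intro fps_expansion_intros Q)
  ultimately have WQ: "W * (Q + 1) = Q - 1"
    using fps_expansion_unique_complex by blast
  \<comment> \<open>The constant term of \<open>Q + 1\<close> is 2; it multiplies the only
    coefficient of \<open>W\<close> that survives in the convolution.\<close>
  have step: "2 * fps_nth W m = fps_nth (Q - 1) m" if "\<And>i. i < m \<Longrightarrow> fps_nth W i = 0" for m
  proof -
    have "fps_nth (W * (Q + 1)) m = (\<Sum>i=0..m. fps_nth W i * fps_nth (Q + 1) (m - i))"
      by (rule fps_mult_nth)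
    also have "\<dots> = (\<Sum>i\<in>{m}. fps_nth W i * fps_nth (Q + 1) (m - i))"
      using that by (intro sum.mono_neutral_right) auto
    finally show ?thesis
      using Q0 unfolding WQ by simp
  qed
  \<comment> \<open>\<open>Q - 1\<close> has no terms below order \<open>n\<close>, and
    \<open>step\<close> passes this on to \<open>W\<close> order by order.\<close>
  have W0: "fps_nth W m = 0" if "m < n" for m
    using that
  proof (induction m rule: less_induct)
    case (less m)
    then have "2 * fps_nth W m = fps_nth (Q - 1) m"
      by (intro step) auto
    then show ?case
      using Q0 Qm[of m] less.prems by (cases "m = 0") auto
  qed
  have "2 * fps_nth W n = fps_nth P n"
    using step[of n] W0 Qn n by simp
  moreover have "cmod (fps_nth W n) \<le> 1"
    using norm_Cayley_less_1 q_pos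
    by (intro fps_nth_le_1_of_maps_into_unit_disc[OF w_hol _ W]) (auto simp: w_def intro: less_imp_le)
  ultimately show ?thesis
    by (metis mult.right_neutral mult_left_mono norm_mult norm_numeral zero_le_numeral)
qed

section \<open>Power series of the branch powers\<close>

lemma branch_power_holomorphic:
  assumes "is_log_branch h L"
  shows "branch_power h s holomorphic_on unit_disc"
proof -
  have "(\<lambda>z. exp (of_real s * L z)) holomorphic_on unit_disc"
    using assms unfolding is_log_branch_def
    by (intro holomorphic_intros analytic_imp_holomorphic) auto
  then show ?thesis
    by (rule holomorphic_transform) (simp add: branch_power_eq[OF assms])
qed

lemma fps_nth_2_compose:
  fixes F G :: "'a::comm_ring_1 fps"
  assumes "fps_nth G 0 = 0"
  shows "fps_nth (F oo G) 2 = fps_nth F 1 * fps_nth G 2 + fps_nth F 2 * fps_nth G 1 ^ 2"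
  using assms
  by (simp add: fps_compose_nth numeral_2_eq_2 fps_mult_nth)

lemma fps_nth_3_compose:
  fixes F G :: "'a::comm_ring_1 fps"
  assumes "fps_nth G 0 = 0"
  shows "fps_nth (F oo G) 3 = fps_nth F 1 * fps_nth G 3
    + 2 * fps_nth F 2 * fps_nth G 1 * fps_nth G 2 + fps_nth F 3 * fps_nth G 1 ^ 3"
  using assms
  by (simp add: fps_compose_nth numeral_3_eq_3 numeral_2_eq_2 fps_mult_nth algebra_simps)

text \<open>Near 0 the power is \<open>exp (s * L)\<close> while \<open>h\<close> itself is
  \<open>exp L\<close>. Expanding both in terms of the series \<open>M\<close> of \<open>L\<close>
  and eliminating the coefficients of \<open>M\<close> gives the binomial formula up to order
  2.\<close>

lemma branch_power_expansion:
  assumes L: "is_log_branch h L" and H: "h has_fps_expansion H"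
  obtains B where "branch_power h s has_fps_expansion B" "fps_nth B 0 = 1"
    "fps_nth B 1 = of_real s * fps_nth H 1"
    "fps_nth B 2 = of_real s * fps_nth H 2 + of_real (s * (s - 1) / 2) * fps_nth H 1 ^ 2"
proof -
  define M where "M = fps_expansion L 0"
  have LM: "L has_fps_expansion M"
    unfolding M_def using L
    by (intro has_fps_expansion_fps_expansion[of unit_disc])
      (auto simp: is_log_branch_def analytic_imp_holomorphic)
  have M0: "fps_nth M 0 = 0"
    using L has_fps_expansion_imp_0_eq_fps_nth_0[OF LM] by (simp add: is_log_branch_def)
  have E: "((\<lambda>z. exp (c * z)) \<circ> L) has_fps_expansion (fps_exp c oo M)" for c
    by (intro fps_expansion_intros LM M0)
  have "((\<lambda>z. exp (1 * z)) \<circ> L) has_fps_expansion H \<longleftrightarrow> h has_fps_expansion H"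
    using L by (intro has_fps_expansion_cong refl eventually_mono[OF eventually_nhds_in_open[of unit_disc]])
      (auto simp: is_log_branch_def)
  then have HM: "H = fps_exp 1 oo M"
    using E[of 1] H fps_expansion_unique_complex by blast
  have H1: "fps_nth H 1 = fps_nth M 1"
    unfolding HM by (simp add: fps_compose_nth M0)
  have H2: "fps_nth H 2 = fps_nth M 2 + fps_nth M 1 ^ 2 / 2"
    unfolding HM fps_nth_2_compose[OF M0] by simp
  show thesis
  proof
    have "((\<lambda>z. exp (of_real s * z)) \<circ> L) has_fps_expansion (fps_exp (of_real s) oo M) \<longleftrightarrow>
        branch_power h s has_fps_expansion (fps_exp (of_real s) oo M)"
      by (intro has_fps_expansion_cong refl eventually_mono[OF eventually_nhds_in_open[of unit_disc]])
        (auto simp: branch_power_eq[OF L])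
    then show "branch_power h s has_fps_expansion (fps_exp (of_real s) oo M)"
      using E by blast
    show "fps_nth (fps_exp (of_real s) oo M) 0 = 1"
      by simp
    show "fps_nth (fps_exp (of_real s) oo M) 1 = of_real s * fps_nth H 1"
      unfolding H1 by (simp add: fps_compose_nth M0)
    show "fps_nth (fps_exp (of_real s) oo M) 2
        = of_real s * fps_nth H 2 + of_real (s * (s - 1) / 2) * fps_nth H 1 ^ 2"
      unfolding H1 H2 fps_nth_2_compose[OF M0] by (simp add: field_simps power2_eq_square)
  qed
qed

section \<open>The quotient f(z)/z and the half-plane condition\<close>

lemma quotient_by_id_expansion:
  assumes F: "f has_fps_expansion F" and F0: "fps_nth F 0 = 0" and F1: "fps_nth F 1 = 1"
  shows "quotient_by_id f has_fps_expansion fps_shift 1 F"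
proof -
  have "F \<noteq> 0"
    using F1 by auto
  moreover have "subdegree F \<ge> 1"
    using F0 \<open>F \<noteq> 0\<close> by (intro subdegree_geI) auto
  ultimately have "(\<lambda>z. if z = 0 then fps_nth F 1 else f z / z ^ 1) has_fps_expansion fps_shift 1 F"
    by (intro has_fps_expansion_shift F) auto
  then show ?thesis
    unfolding F1 quotient_by_id_def power_one_right .
qed

text \<open>Since \<open>f 0 = 0\<close>, injectivity excludes further zeros of \<open>f\<close>.
  Analyticity of the quotient at 0 comes from the shifted power series, elsewhere from
  division.\<close>

lemma quotient_by_id_has_log_branch:
  assumes "univalent f" and F: "f has_fps_expansion F" and F0: "fps_nth F 0 = 0"
    and F1: "fps_nth F 1 = 1"
  shows "\<exists>L. is_log_branch (quotient_by_id f) L"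
proof (rule is_log_branch_exists)
  have an: "f analytic_on unit_disc" and inj: "inj_on f unit_disc"
    using assms by (auto simp: univalent_def)
  have f0: "f 0 = 0"
    using has_fps_expansion_imp_0_eq_fps_nth_0[OF F] F0 by simp
  show "quotient_by_id f analytic_on unit_disc"
  proof (subst analytic_on_analytic_at, intro ballI)
    fix z :: complex assume z: "z \<in> unit_disc"
    show "quotient_by_id f analytic_on {z}"
    proof (cases "z = 0")
      case True
      then show ?thesis
        using has_fps_expansion_imp_analytic_0[OF quotient_by_id_expansion[OF F F0 F1]] by simp
    next
      case False
      have "(\<lambda>z. f z / z) analytic_on {z}"
        using False z analytic_on_subset[OF an, of "{z}"] by (intro analytic_intros) auto
      moreover have "(\<lambda>z. f z / z) analytic_on {z} \<longleftrightarrow> quotient_by_id f analytic_on {z}"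
        using False
        by (intro analytic_at_cong refl eventually_mono[OF eventually_nhds_in_open[of "- {0}"]])
          (auto simp: quotient_by_id_def)
      ultimately show ?thesis
        by blast
    qed
  qed
  show "quotient_by_id f z \<noteq> 0" if "z \<in> unit_disc" for z
    using inj_onD[OF inj, of z 0] f0 that by (auto simp: quotient_by_id_def)
  show "quotient_by_id f 0 = 1"
    by (simp add: quotient_by_id_def)
qed

text \<open>Stated for an arbitrary normalized univalent function, so that it serves for
  \<open>f\<close> and for the extension of its inverse. The bounds are those on the first two
  coefficients of the normalized function \<open>p\<close> of positive real part.\<close>

lemma half_plane_condition_coefficient_bounds:
  assumes uni: "univalent f" and F: "f has_fps_expansion F" and F0: "fps_nth F 0 = 0"
    and F1: "fps_nth F 1 = 1" and hp: "half_plane_condition \<mu> \<beta> lam f" and \<beta>: "\<beta> < 1"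
  shows "cmod (of_real (lam + \<mu>) * fps_nth F 2) \<le> 2 * (1 - \<beta>)"
    and "cmod (of_real (2 * lam + \<mu>) * (fps_nth F 3 + of_real ((\<mu> - 1) / 2) * fps_nth F 2 ^ 2))
      \<le> 2 * (1 - \<beta>)"
proof -
  let ?h = "quotient_by_id f"
  obtain L where L: "is_log_branch ?h L"
    using quotient_by_id_has_log_branch[OF uni F F0 F1] by blast
  have H: "?h has_fps_expansion fps_shift 1 F"
    by (rule quotient_by_id_expansion[OF F F0 F1])
  have nth_shift: "fps_nth (fps_shift 1 F) 1 = fps_nth F 2" "fps_nth (fps_shift 1 F) 2 = fps_nth F 3"
    by (simp_all add: numeral_3_eq_3 numeral_2_eq_2)
  obtain B where B: "branch_power ?h \<mu> has_fps_expansion B" and B0: "fps_nth B 0 = 1"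
    and B1: "fps_nth B 1 = of_real \<mu> * fps_nth F 2"
    and B2: "fps_nth B 2 = of_real \<mu> * fps_nth F 3 + of_real (\<mu> * (\<mu> - 1) / 2) * fps_nth F 2 ^ 2"
    using branch_power_expansion[OF L H, of \<mu>, unfolded nth_shift] by blast
  obtain C where C: "branch_power ?h (\<mu> - 1) has_fps_expansion C" and C0: "fps_nth C 0 = 1"
    and C1: "fps_nth C 1 = of_real (\<mu> - 1) * fps_nth F 2"
    and C2: "fps_nth C 2 = of_real (\<mu> - 1) * fps_nth F 3
      + of_real ((\<mu> - 1) * (\<mu> - 1 - 1) / 2) * fps_nth F 2 ^ 2"
    using branch_power_expansion[OF L H, of "\<mu> - 1", unfolded nth_shift] by blast
  define \<Phi> where "\<Phi> z = (1 - of_real lam) * branch_power ?h \<mu> z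
    + of_real lam * deriv f z * branch_power ?h (\<mu> - 1) z" for z
  define p where "p z = of_real (1 / (1 - \<beta>)) * (\<Phi> z - of_real \<beta>)" for z
  define P where "P = fps_const (of_real (1 / (1 - \<beta>))) *
    ((fps_const (1 - of_real lam) * B + fps_const (of_real lam) * fps_deriv F * C)
      - fps_const (of_real \<beta>))"
  have P: "p has_fps_expansion P"
    unfolding p_def P_def \<Phi>_def by (intro fps_expansion_intros B C F)
  have "f holomorphic_on unit_disc"
    using uni by (auto simp: univalent_def intro: analytic_imp_holomorphic)
  then have p_hol: "p holomorphic_on unit_disc"
    unfolding p_def \<Phi>_def
    by (intro holomorphic_intros branch_power_holomorphic[OF L]) auto
  have p_pos: "Re (p z) > 0" if "z \<in> unit_disc" for z
  proof -
    have "Re (p z) = (Re (\<Phi> z) - \<beta>) / (1 - \<beta>)"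
      unfolding p_def by (simp flip: of_real_diff)
    moreover have "Re (\<Phi> z) > \<beta>"
      using hp that unfolding half_plane_condition_def \<Phi>_def by blast
    ultimately show ?thesis
      using \<beta> by simp
  qed
  have \<beta>': "of_real (1 - \<beta>) \<noteq> (0::complex)"
    using \<beta> by (simp only: of_real_eq_0_iff)
  have P0: "fps_nth P 0 = 1"
    using \<beta>' F1 by (simp add: P_def B0 C0 field_simps)
  have P_bound: "cmod (of_real (1 - \<beta>) * fps_nth P n) \<le> 2 * (1 - \<beta>)" if "n > 0" for n
    using mult_left_mono[OF Caratheodory_coefficient_bound[OF p_hol p_pos P P0 that], of "1 - \<beta>"] \<beta>
    unfolding norm_mult norm_of_real by simp
  have P_nth: "of_real (1 - \<beta>) * fps_nth P n = (1 - of_real lam) * fps_nth B n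
      + of_real lam * fps_nth (fps_deriv F * C) n" if "n > 0" for n
    using \<beta>' that by (simp add: P_def mult.assoc)
  have D1: "fps_nth (fps_deriv F * C) 1 = fps_nth C 1 + 2 * fps_nth F 2"
    using F1 C0 by (simp add: fps_mult_nth numeral_2_eq_2)
  have D2: "fps_nth (fps_deriv F * C) 2
      = fps_nth C 2 + 2 * fps_nth F 2 * fps_nth C 1 + 3 * fps_nth F 3"
    using F1 C0 by (simp add: fps_mult_nth numeral_2_eq_2 numeral_3_eq_3)
  have "of_real (1 - \<beta>) * fps_nth P 1 = of_real (lam + \<mu>) * fps_nth F 2"
    unfolding P_nth[OF zero_less_one] D1 B1 C1 by (simp add: algebra_simps)
  then show "cmod (of_real (lam + \<mu>) * fps_nth F 2) \<le> 2 * (1 - \<beta>)"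
    using P_bound[of 1] by simp
  \<comment> \<open>The square of the second coefficient is multiplied by \<open>(\<mu> - 1) / 2 *
    ((1 - lam) * \<mu> + lam * (\<mu> - 2) + 4 * lam)\<close>, whose last factor is again
    \<open>2 * lam + \<mu>\<close>.\<close>
  have "of_real (1 - \<beta>) * fps_nth P 2
      = of_real (2 * lam + \<mu>) * (fps_nth F 3 + of_real ((\<mu> - 1) / 2) * fps_nth F 2 ^ 2)"
    unfolding P_nth[OF zero_less_numeral] D2 B2 C1 C2
    by (simp add: field_simps power2_eq_square)
  then show "cmod (of_real (2 * lam + \<mu>) * (fps_nth F 3 + of_real ((\<mu> - 1) / 2) * fps_nth F 2 ^ 2))
      \<le> 2 * (1 - \<beta>)"
    using P_bound[of 2] by simp
qed

section \<open>Expansions of f and of its inverse\<close>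

lemma normalized_expansion_has_fps_expansion:
  assumes "normalized_expansion f a"
  shows "f has_fps_expansion Abs_fps (\<lambda>n. if n = 0 then 0 else if n = 1 then 1 else a n)"
    (is "f has_fps_expansion ?F")
proof (rule has_fps_expansionI)
  have "(\<lambda>n. fps_nth ?F n * z ^ n) sums f z" if "z \<in> unit_disc" for z
  proof -
    \<comment> \<open>The given series starts at order 2 and sums to \<open>f z - z\<close>; the
      entries 0 and 1 of \<open>?F\<close> supply the missing term \<open>z\<close>.\<close>
    have "(\<lambda>n. fps_nth ?F (n + 2) * z ^ (n + 2)) sums (f z - (\<Sum>n<2. fps_nth ?F n * z ^ n))"
      using assms that by (simp add: normalized_expansion_def numeral_2_eq_2)
    then show ?thesis
      by (subst (asm) sums_iff_shift) simp
  qed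
  then show "\<forall>\<^sub>F z in nhds 0. (\<lambda>n. fps_nth ?F n * z ^ n) sums f z"
    by (intro eventually_mono[OF eventually_nhds_in_open[of unit_disc]]) auto
qed

text \<open>Near 0 the composition \<open>g \<circ> f\<close> is the identity, so
  \<open>G oo F = fps_X\<close>; comparing coefficients determines those of \<open>G\<close> one
  after the other.\<close>

lemma univalent_inverse_extension_expansion:
  assumes uni: "univalent f" and F: "f has_fps_expansion F" and F0: "fps_nth F 0 = 0"
    and F1: "fps_nth F 1 = 1" and ext: "univalent_inverse_extension f g"
  obtains G where "g has_fps_expansion G" "fps_nth G 0 = 0" "fps_nth G 1 = 1"
    "fps_nth G 2 = - fps_nth F 2" "fps_nth G 3 = 2 * fps_nth F 2 ^ 2 - fps_nth F 3"
proof
  define G where "G = fps_expansion g 0"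
  obtain r where r: "r > 0" and gr: "\<And>w. w \<in> ball 0 r \<Longrightarrow> g w = the_inv_into unit_disc f w"
    using ext by (auto simp: univalent_inverse_extension_def)
  have inj: "inj_on f unit_disc"
    using uni by (simp add: univalent_def)
  have f0: "f 0 = 0"
    using has_fps_expansion_imp_0_eq_fps_nth_0[OF F] F0 by simp
  show G: "g has_fps_expansion fps_expansion g 0"
    using ext by (intro has_fps_expansion_fps_expansion[of unit_disc])
      (auto simp: univalent_inverse_extension_def univalent_def analytic_imp_holomorphic)
  note G = G[folded G_def]
  \<comment> \<open>\<open>g\<close> is known to invert \<open>f\<close> only on
    \<open>ball 0 r\<close>; by continuity \<open>f\<close> maps a neighbourhood of 0 into that
    ball.\<close>
  have "(f \<longlongrightarrow> f 0) (nhds 0)"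
    using has_fps_expansion_imp_continuous[OF F, of UNIV]
    by (simp add: continuous_within tendsto_nhds_iff)
  then have "\<forall>\<^sub>F z in nhds 0. f z \<in> ball 0 r"
    using r f0 by (auto dest: topological_tendstoD[of _ _ _ "ball 0 r"])
  then have ev: "\<forall>\<^sub>F z in nhds 0. (g \<circ> f) z = z"
    using eventually_nhds_in_open[of unit_disc 0]
    by (rule eventually_elim2) (use gr inj in \<open>auto simp: the_inv_into_f_f\<close>)
  have "(g \<circ> f) has_fps_expansion fps_X"
    using has_fps_expansion_cong[OF ev refl, of fps_X] has_fps_expansion_fps_X by blast
  then have GF: "G oo F = fps_X"
    using has_fps_expansion_compose[OF G F F0] fps_expansion_unique_complex by blast
  have "fps_nth (G oo F) 0 = fps_nth fps_X 0"
    unfolding GF ..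
  then show "fps_nth (fps_expansion g 0) 0 = 0"
    by (simp add: G_def)
  have "fps_nth (G oo F) 1 = fps_nth fps_X 1"
    unfolding GF ..
  then have G1: "fps_nth G 1 = 1"
    using F0 F1 by (simp add: fps_compose_nth)
  then show "fps_nth (fps_expansion g 0) 1 = 1"
    by (simp add: G_def)
  have "fps_nth (G oo F) 2 = fps_nth fps_X 2"
    unfolding GF ..
  then have G2: "fps_nth G 2 = - fps_nth F 2"
    using F1 G1 unfolding fps_nth_2_compose[OF F0] by (simp add: add_eq_0_iff)
  then show "fps_nth (fps_expansion g 0) 2 = - fps_nth F 2"
    by (simp add: G_def)
  have "fps_nth (G oo F) 3 = fps_nth fps_X 3"
    unfolding GF ..
  then have "fps_nth F 3 - 2 * fps_nth F 2 ^ 2 + fps_nth G 3 = 0"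
    using F1 G1 G2 unfolding fps_nth_3_compose[OF F0] by (simp add: power2_eq_square mult.assoc)
  then show "fps_nth (fps_expansion g 0) 3 = 2 * fps_nth F 2 ^ 2 - fps_nth F 3"
    unfolding G_def by algebra
qed

section \<open>Elimination between the coefficient relations of f and g\<close>

theorem theorem3p1:
  fixes \<beta> lam \<mu> :: real and f :: "complex \<Rightarrow> complex" and a :: "nat \<Rightarrow> complex"
  assumes "0 \<le> \<beta>" "\<beta> < 1" "lam \<ge> 1" "\<mu> \<ge> 0"
    and "f \<in> class_N \<mu> \<beta> lam"
    and "normalized_expansion f a"
  shows "cmod (a 2) \<le> min (sqrt (4 * (1 - \<beta>) / ((\<mu> + 1) * (2 * lam + \<mu>))))
                           (2 * (1 - \<beta>) / (lam + \<mu>))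
       \<and> cmod (a 3) \<le> (if \<mu> < 1
            then min (4 * (1 - \<beta>) / ((\<mu> + 1) * (2 * lam + \<mu>)))
                     (4 * (1 - \<beta>)^2 / (lam + \<mu>)^2 + 2 * (1 - \<beta>) / (2 * lam + \<mu>))
            else 2 * (1 - \<beta>) / (2 * lam + \<mu>))"
proof -
  define F where "F = Abs_fps (\<lambda>n. if n = 0 then 0 else if n = 1 then 1 else a n)"
  have F: "f has_fps_expansion F"
    unfolding F_def by (rule normalized_expansion_has_fps_expansion) fact
  have F_nth: "fps_nth F 0 = 0" "fps_nth F 1 = 1" "fps_nth F 2 = a 2" "fps_nth F 3 = a 3"
    by (simp_all add: F_def)
  have uni_f: "univalent f" and hp_f: "half_plane_condition \<mu> \<beta> lam f"
    using assms(5) by (auto simp: class_N_def bi_univalent_class_def)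
  obtain g where ext: "univalent_inverse_extension f g" and hp_g: "half_plane_condition \<mu> \<beta> lam g"
    using assms(5) by (auto simp: class_N_def)
  then have uni_g: "univalent g"
    by (simp add: univalent_inverse_extension_def)
  obtain G where G: "g has_fps_expansion G" "fps_nth G 0 = 0" "fps_nth G 1 = 1"
    and G_nth: "fps_nth G 2 = - a 2" "fps_nth G 3 = 2 * a 2 ^ 2 - a 3"
    using univalent_inverse_extension_expansion[OF uni_f F F_nth(1,2) ext] unfolding F_nth by blast
  define c where "c = 2 * (1 - \<beta>)"
  define K where "K = 2 * lam + \<mu>"
  \<comment> \<open>\<open>u\<close> and \<open>v\<close> are the second-order expressions of
    \<open>f\<close> and \<open>g\<close>; the terms in the square of \<open>a 2\<close> have
    factors \<open>(\<mu> - 1) / 2\<close> and \<open>(\<mu> + 3) / 2\<close>, those in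
    \<open>a 3\<close> are opposite.\<close>
  define u where "u = of_real K * (a 3 + of_real ((\<mu> - 1) / 2) * a 2 ^ 2)"
  define v where "v = of_real K * (2 * a 2 ^ 2 - a 3 + of_real ((\<mu> - 1) / 2) * a 2 ^ 2)"
  have a2_bound: "cmod (of_real (lam + \<mu>) * a 2) \<le> c" and u: "cmod u \<le> c"
    using half_plane_condition_coefficient_bounds[OF uni_f F F_nth(1,2) hp_f assms(2)]
    unfolding F_nth c_def u_def K_def by auto
  have v: "cmod v \<le> c"
    using half_plane_condition_coefficient_bounds(2)[OF uni_g G hp_g assms(2)]
    unfolding G_nth c_def v_def K_def by simp
  have K: "K > 0" and lm: "lam + \<mu> > 0" and \<mu>1: "\<mu> + 1 > 0"
    using assms by (auto simp: K_def)
  have a2: "cmod (a 2) \<le> c / (lam + \<mu>)"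
    using a2_bound lm unfolding norm_mult norm_of_real by (simp add: field_simps)
  have "of_real ((\<mu> + 1) * K) * a 2 ^ 2 = u + v"
    by (simp add: u_def v_def field_simps)
  then have "(\<mu> + 1) * K * cmod (a 2) ^ 2 = cmod (u + v)"
    using K \<mu>1 by (metis abs_of_pos mult_pos_pos norm_mult norm_of_real norm_power)
  then have "(\<mu> + 1) * K * cmod (a 2) ^ 2 \<le> 2 * c"
    using norm_triangle_ineq[of u v] u v by simp
  then have "cmod (a 2) ^ 2 \<le> 2 * c / ((\<mu> + 1) * K)"
    using K \<mu>1 by (simp add: pos_le_divide_eq mult.commute)
  then have a2': "cmod (a 2) \<le> sqrt (2 * c / ((\<mu> + 1) * K))"
    by (rule real_le_rsqrt)
  \<comment> \<open>The weights \<open>\<mu> + 3\<close> and \<open>1 - \<mu>\<close> are chosen to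
    cancel the square of \<open>a 2\<close>.\<close>
  have "of_real (2 * (\<mu> + 1) * K) * a 3 = of_real (\<mu> + 3) * u + of_real (1 - \<mu>) * v"
    by (simp add: u_def v_def field_simps)
  then have "2 * (\<mu> + 1) * K * cmod (a 3) = cmod (of_real (\<mu> + 3) * u + of_real (1 - \<mu>) * v)"
    using K \<mu>1 by (metis abs_of_pos mult_pos_pos norm_mult norm_of_real zero_less_numeral)
  also have "\<dots> \<le> (\<mu> + 3) * cmod u + \<bar>1 - \<mu>\<bar> * cmod v"
    using norm_triangle_ineq[of "of_real (\<mu> + 3) * u" "of_real (1 - \<mu>) * v"] assms(4)
    unfolding norm_mult norm_of_real by simp
  also have "\<dots> \<le> (\<mu> + 3) * c + \<bar>1 - \<mu>\<bar> * c"
    using u v assms(4) by (intro add_mono mult_left_mono) auto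
  \<comment> \<open>The factor \<open>\<mu> + 3 + \<bar>1 - \<mu>\<bar>\<close> is 4 for
    \<open>\<mu> < 1\<close> and \<open>2 * (\<mu> + 1)\<close> for
    \<open>\<mu> \<ge> 1\<close>.\<close>
  finally have a3: "2 * (\<mu> + 1) * K * cmod (a 3) \<le> (\<mu> + 3 + \<bar>1 - \<mu>\<bar>) * c"
    by (simp add: algebra_simps)
  \<comment> \<open>The second entry of the minimum for \<open>a 3\<close> arises by splitting off
    the square of \<open>a 2\<close> and using the linear bound \<open>a2\<close>.\<close>
  have "of_real (2 * K) * (a 3 - a 2 ^ 2) = u - v"
    by (simp add: u_def v_def field_simps)
  then have "2 * K * cmod (a 3 - a 2 ^ 2) = cmod (u - v)"
    using K by (metis abs_of_pos mult_pos_pos norm_mult norm_of_real zero_less_numeral)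
  then have "2 * K * cmod (a 3 - a 2 ^ 2) \<le> 2 * c"
    using norm_triangle_ineq4[of u v] u v by simp
  then have "cmod (a 3 - a 2 ^ 2) \<le> c / K"
    using K by (simp add: field_simps)
  moreover have "cmod (a 2 ^ 2) \<le> (c / (lam + \<mu>)) ^ 2"
    unfolding norm_power by (rule power_mono[OF a2]) simp
  ultimately have a3': "cmod (a 3) \<le> (c / (lam + \<mu>)) ^ 2 + c / K"
    using norm_triangle_ineq[of "a 2 ^ 2" "a 3 - a 2 ^ 2"] by simp
  have "cmod (a 3) \<le> 2 * c / ((\<mu> + 1) * K)" if "\<mu> < 1"
  proof -
    have "cmod (a 3) * ((\<mu> + 1) * K) \<le> 2 * c"
      using a3 that by (simp add: algebra_simps)
    then show ?thesis
      using K \<mu>1 by (simp add: pos_le_divide_eq)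
  qed
  moreover have "cmod (a 3) \<le> c / K" if "\<mu> \<ge> 1"
  proof -
    have "(2 * (\<mu> + 1)) * (K * cmod (a 3)) \<le> (2 * (\<mu> + 1)) * c"
      using a3 that by (simp add: algebra_simps)
    then have "K * cmod (a 3) \<le> c"
      using \<mu>1 by (subst (asm) mult_le_cancel_left_pos) simp_all
    then show ?thesis
      using K by (simp add: pos_le_divide_eq mult.commute)
  qed
  moreover have "4 * (1 - \<beta>) = 2 * c" "4 * (1 - \<beta>) ^ 2 / (lam + \<mu>) ^ 2 = (c / (lam + \<mu>)) ^ 2"
    by (simp_all add: c_def power2_eq_square field_simps)
  ultimately show ?thesis
    using a2 a2' a3' unfolding c_def[symmetric] K_def[symmetric] by simp
qed

end
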